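(* Let $\mathbf{F}_q$ be a finite field of characteristic $2$ and let $n$ be a positive integer with $n\neq 2$ and $n\neq 4$. Then the Lie algebra $\mathfrak{sl}_n(\mathbf{F}_q)$ is $2$-generated.
   Context: $\mathfrak{sl}_n(\mathbf{F}_q)$ is the Lie algebra over $\mathbf{F}_q$ of traceless $n\times n$ matrices with bracket $[x,y]=xy-yx$. A Lie algebra over $\mathbf{F}_q$ is $2$-generated if there are two elements such that the smallest Lie subalgebra over $\mathbf{F}_q$ containing them is the whole algebra. *)

theory Defs
  imports "HOL-Algebra.Module" "Jordan_Normal_Form.VS_Connect"
begin

section \<open>Lie algebras\<close>

text \<open>As in \<^locale>\<open>Module.module\<close>, the inherited fields \<^const>\<open>mult\<close> and \<^const>\<open>one\<close> of the
  record carry no meaning; only the carrier, addition, zero, scalar multiplication and bracket do.\<close>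

record ('a, 'b) lie_alg = "('a, 'b) module" +
  bracket :: "'b \<Rightarrow> 'b \<Rightarrow> 'b"

text \<open>The bracket is required to be alternating, which in characteristic 2 is stronger than
  being antisymmetric.\<close>

locale lie_algebra = K?: field K + Module.module K L
  for K :: "('a, 'c) ring_scheme" (structure)
    and L :: "('a, 'b, 'd) lie_alg_scheme" (structure) +
  assumes bracket_closed:
      "\<lbrakk>x \<in> carrier L; y \<in> carrier L\<rbrakk> \<Longrightarrow> bracket L x y \<in> carrier L"
    and bracket_add_left:
      "\<lbrakk>x \<in> carrier L; y \<in> carrier L; z \<in> carrier L\<rbrakk> \<Longrightarrow>
        bracket L (x \<oplus>\<^bsub>L\<^esub> y) z = bracket L x z \<oplus>\<^bsub>L\<^esub> bracket L y z"
    and bracket_add_right: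
      "\<lbrakk>x \<in> carrier L; y \<in> carrier L; z \<in> carrier L\<rbrakk> \<Longrightarrow>
        bracket L x (y \<oplus>\<^bsub>L\<^esub> z) = bracket L x y \<oplus>\<^bsub>L\<^esub> bracket L x z"
    and bracket_smult_left:
      "\<lbrakk>a \<in> carrier K; x \<in> carrier L; y \<in> carrier L\<rbrakk> \<Longrightarrow>
        bracket L (a \<odot>\<^bsub>L\<^esub> x) y = a \<odot>\<^bsub>L\<^esub> bracket L x y"
    and bracket_smult_right:
      "\<lbrakk>a \<in> carrier K; x \<in> carrier L; y \<in> carrier L\<rbrakk> \<Longrightarrow>
        bracket L x (a \<odot>\<^bsub>L\<^esub> y) = a \<odot>\<^bsub>L\<^esub> bracket L x y"
    and bracket_alternating:
      "x \<in> carrier L \<Longrightarrow> bracket L x x = \<zero>\<^bsub>L\<^esub>"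
    and jacobi:
      "\<lbrakk>x \<in> carrier L; y \<in> carrier L; z \<in> carrier L\<rbrakk> \<Longrightarrow>
        bracket L x (bracket L y z) \<oplus>\<^bsub>L\<^esub> bracket L y (bracket L z x)
          \<oplus>\<^bsub>L\<^esub> bracket L z (bracket L x y) = \<zero>\<^bsub>L\<^esub>"

definition lie_subalgebra ::
    "'b set \<Rightarrow> ('a, 'c) ring_scheme \<Rightarrow> ('a, 'b, 'd) lie_alg_scheme \<Rightarrow> bool" where
  "lie_subalgebra H K L \<longleftrightarrow>
     Module.submodule H K L \<and> (\<forall>x\<in>H. \<forall>y\<in>H. bracket L x y \<in> H)"

definition lie_generated ::
    "('a, 'c) ring_scheme \<Rightarrow> ('a, 'b, 'd) lie_alg_scheme \<Rightarrow> 'b set \<Rightarrow> 'b set" where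
  "lie_generated K L X = \<Inter>{H. lie_subalgebra H K L \<and> X \<subseteq> H}"

definition two_generated ::
    "('a, 'c) ring_scheme \<Rightarrow> ('a, 'b, 'd) lie_alg_scheme \<Rightarrow> bool" where
  "two_generated K L \<longleftrightarrow>
     (\<exists>x\<in>carrier L. \<exists>y\<in>carrier L. lie_generated K L {x, y} = carrier L)"

context lie_algebra
begin

lemma lie_subalgebra_carrier: "lie_subalgebra (carrier L) K L"
  using carrier_is_submodule bracket_closed by (auto simp: lie_subalgebra_def)

lemma lie_subalgebra_lie_generated:
  assumes "X \<subseteq> carrier L"
  shows "lie_subalgebra (lie_generated K L X) K L"
  unfolding lie_subalgebra_def
proof
  have sub: "Module.submodule H K L" if "lie_subalgebra H K L" for H
    using that by (simp add: lie_subalgebra_def)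
  have zero: "\<zero>\<^bsub>L\<^esub> \<in> H" if "lie_subalgebra H K L" for H
    using sub[OF that] subgroup.one_closed[of H "add_monoid L"]
    by (simp add: Module.submodule_def)
  show "Module.submodule (lie_generated K L X) K L"
  proof (rule submoduleI)
    show "lie_generated K L X \<subseteq> carrier L"
      using lie_subalgebra_carrier assms by (auto simp: lie_generated_def)
  qed (auto simp: lie_generated_def zero dest: sub intro: submoduleE)
  show "\<forall>x\<in>lie_generated K L X. \<forall>y\<in>lie_generated K L X. bracket L x y \<in> lie_generated K L X"
    by (auto simp: lie_generated_def lie_subalgebra_def)
qed

lemma lie_generated_incl: "X \<subseteq> lie_generated K L X"
  by (auto simp: lie_generated_def)

lemma lie_generated_least:
  "lie_subalgebra H K L \<Longrightarrow> X \<subseteq> H \<Longrightarrow> lie_generated K L X \<subseteq> H"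
  by (auto simp: lie_generated_def)

end

section \<open>The special linear Lie algebra\<close>

definition mat_trace :: "'a :: comm_monoid_add mat \<Rightarrow> 'a" where
  "mat_trace A = (\<Sum>i<dim_row A. A $$ (i, i))"

definition sl :: "'a :: field itself \<Rightarrow> nat \<Rightarrow> ('a, 'a mat) lie_alg" where
  "sl ty n =
    \<lparr>carrier = {A \<in> carrier_mat n n. mat_trace A = 0},
     mult = (*), one = 1\<^sub>m n, zero = 0\<^sub>m n n, add = (+), smult = (\<cdot>\<^sub>m),
     bracket = (\<lambda>x y. x * y - y * x)\<rparr>"

lemma sl_simps [simp]:
  "carrier (sl ty n) = {A \<in> carrier_mat n n. mat_trace A = 0}"
  "add (sl ty n) = (+)"
  "zero (sl ty n) = 0\<^sub>m n n"
  "smult (sl ty n) = (\<cdot>\<^sub>m)"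
  "bracket (sl ty n) = (\<lambda>x y. x * y - y * x)"
  by (simp_all add: sl_def)

lemma mat_trace_mult_commute:
  fixes A B :: "'a :: comm_ring_1 mat"
  assumes "A \<in> carrier_mat n n" "B \<in> carrier_mat n n"
  shows "mat_trace (A * B) = mat_trace (B * A)"
proof -
  have "mat_trace (A * B) = (\<Sum>i<n. \<Sum>j<n. A $$ (i, j) * B $$ (j, i))"
    using assms by (auto simp: mat_trace_def scalar_prod_def lessThan_atLeast0 intro!: sum.cong)
  also have "\<dots> = (\<Sum>j<n. \<Sum>i<n. B $$ (j, i) * A $$ (i, j))"
    by (subst sum.swap) (simp add: mult.commute)
  also have "\<dots> = mat_trace (B * A)"
    using assms by (auto simp: mat_trace_def scalar_prod_def lessThan_atLeast0 intro!: sum.cong)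
  finally show ?thesis .
qed

lemma mat_trace_add:
  fixes A B :: "'a :: comm_ring_1 mat"
  assumes "A \<in> carrier_mat n n" "B \<in> carrier_mat n n"
  shows "mat_trace (A + B) = mat_trace A + mat_trace B"
  using assms by (auto simp: mat_trace_def sum.distrib)

lemma mat_trace_minus:
  fixes A B :: "'a :: comm_ring_1 mat"
  assumes "A \<in> carrier_mat n n" "B \<in> carrier_mat n n"
  shows "mat_trace (A - B) = mat_trace A - mat_trace B"
  using assms by (auto simp: mat_trace_def sum_subtractf)

lemma mat_trace_smult:
  fixes A :: "'a :: comm_ring_1 mat"
  assumes "A \<in> carrier_mat n n"
  shows "mat_trace (c \<cdot>\<^sub>m A) = c * mat_trace A"
  using assms by (auto simp: mat_trace_def sum_distrib_left)

lemma mat_jacobi: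
  fixes x y z :: "'a :: comm_ring_1 mat"
  assumes [simp]: "x \<in> carrier_mat n n" "y \<in> carrier_mat n n" "z \<in> carrier_mat n n"
  shows "(x * (y * z - z * y) - (y * z - z * y) * x) + (y * (z * x - x * z) - (z * x - x * z) * y)
     + (z * (x * y - y * x) - (x * y - y * x) * z) = 0\<^sub>m n n"
proof -
  have [simp]: "dim_row x = n" "dim_col x = n" "dim_row y = n" "dim_col y = n"
    "dim_row z = n" "dim_col z = n"
    using assms by (auto simp only: carrier_matD)
  have *: "(x * (y * z) - x * (z * y) - (y * (z * x) - z * (y * x)))
     + (y * (z * x) - y * (x * z) - (z * (x * y) - x * (z * y)))
     + (z * (x * y) - z * (y * x) - (x * (y * z) - y * (x * z))) = 0\<^sub>m n n"
    by (rule eq_matI) (simp_all del: index_mult_mat(1))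
  show ?thesis
    using *
    by (simp add: mult_minus_distrib_mat[of _ n n _ n] minus_mult_distrib_mat[of _ n n _ _ n]
        assoc_mult_mat[of _ n n _ n _ n] mult_carrier_mat[of _ n n _ n] minus_carrier_mat)
qed

lemma lie_algebra_sl: "lie_algebra (class_ring :: 'a :: field ring) (sl TYPE('a) n)"
proof -
  have tr0: "mat_trace (0\<^sub>m n n :: 'a mat) = 0"
    by (simp add: mat_trace_def)
  have ag: "abelian_group (sl TYPE('a) n)"
  proof (rule abelian_groupI)
    fix x assume x: "x \<in> carrier (sl TYPE('a) n)"
    then have "- x = (-1) \<cdot>\<^sub>m x" by auto
    then have "mat_trace (- x) = 0" using x by (simp add: mat_trace_smult[of _ n])
    then show "\<exists>y\<in>carrier (sl TYPE('a) n). y \<oplus>\<^bsub>sl TYPE('a) n\<^esub> x = \<zero>\<^bsub>sl TYPE('a) n\<^esub>"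
      using x by (intro bexI[of _ "- x"]) (auto simp: uminus_l_inv_mat)
  qed (auto simp: mat_trace_add tr0 comm_add_mat assoc_add_mat[of _ n n])
  have cr: "cring (class_ring :: 'a ring)"
    by unfold_locales
  have fd: "field (class_ring :: 'a ring)"
    by unfold_locales
  have md: "Module.module (class_ring :: 'a ring) (sl TYPE('a) n)"
    by (rule Module.moduleI[OF cr ag])
      (auto simp: mat_trace_smult[of _ n] add_smult_distrib_right_mat[of _ n n]
        add_smult_distrib_left_mat[of _ n n])
  show ?thesis
  proof (intro lie_algebra.intro fd md lie_algebra_axioms.intro)
    fix x y assume "x \<in> carrier (sl TYPE('a) n)" "y \<in> carrier (sl TYPE('a) n)"
    then show "bracket (sl TYPE('a) n) x y \<in> carrier (sl TYPE('a) n)"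
      by (auto simp: mat_trace_minus[of _ n] mat_trace_mult_commute[of x n y])
  next
    fix x y z
    assume "x \<in> carrier (sl TYPE('a) n)" "y \<in> carrier (sl TYPE('a) n)"
      "z \<in> carrier (sl TYPE('a) n)"
    then have [simp]: "x \<in> carrier_mat n n" "y \<in> carrier_mat n n" "z \<in> carrier_mat n n"
      by auto
    have [simp]: "dim_row x = n" "dim_col x = n" "dim_row y = n" "dim_col y = n"
      "dim_row z = n" "dim_col z = n"
      by (auto simp: carrier_matD[of _ n n])
    show "bracket (sl TYPE('a) n) (x \<oplus>\<^bsub>sl TYPE('a) n\<^esub> y) z =
       bracket (sl TYPE('a) n) x z \<oplus>\<^bsub>sl TYPE('a) n\<^esub> bracket (sl TYPE('a) n) y z"
      by (simp add: add_mult_distrib_mat[of _ n n _ _ n] mult_add_distrib_mat[of _ n n _ n])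
        (rule eq_matI; simp del: index_mult_mat(1))
    show "bracket (sl TYPE('a) n) x (y \<oplus>\<^bsub>sl TYPE('a) n\<^esub> z) =
       bracket (sl TYPE('a) n) x y \<oplus>\<^bsub>sl TYPE('a) n\<^esub> bracket (sl TYPE('a) n) x z"
      by (simp add: add_mult_distrib_mat[of _ n n _ _ n] mult_add_distrib_mat[of _ n n _ n])
        (rule eq_matI; simp del: index_mult_mat(1))
    show "bracket (sl TYPE('a) n) x (bracket (sl TYPE('a) n) y z)
        \<oplus>\<^bsub>sl TYPE('a) n\<^esub> bracket (sl TYPE('a) n) y (bracket (sl TYPE('a) n) z x)
        \<oplus>\<^bsub>sl TYPE('a) n\<^esub> bracket (sl TYPE('a) n) z (bracket (sl TYPE('a) n) x y)
        = \<zero>\<^bsub>sl TYPE('a) n\<^esub>"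
      using mat_jacobi[of x n y z] by simp
  next
    fix a :: 'a and x y
    assume "x \<in> carrier (sl TYPE('a) n)" "y \<in> carrier (sl TYPE('a) n)"
    then have [simp]: "x \<in> carrier_mat n n" "y \<in> carrier_mat n n"
      by auto
    have [simp]: "dim_row x = n" "dim_col x = n" "dim_row y = n" "dim_col y = n"
      by (auto simp: carrier_matD[of _ n n])
    show "bracket (sl TYPE('a) n) (a \<odot>\<^bsub>sl TYPE('a) n\<^esub> x) y =
        a \<odot>\<^bsub>sl TYPE('a) n\<^esub> bracket (sl TYPE('a) n) x y"
      by (simp add: mult_smult_assoc_mat[of _ n n _ n] mult_smult_distrib[of _ n n _ n])
        (rule eq_matI; simp add: right_diff_distrib del: index_mult_mat(1))
    show "bracket (sl TYPE('a) n) x (a \<odot>\<^bsub>sl TYPE('a) n\<^esub> y) =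
        a \<odot>\<^bsub>sl TYPE('a) n\<^esub> bracket (sl TYPE('a) n) x y"
      by (simp add: mult_smult_assoc_mat[of _ n n _ n] mult_smult_distrib[of _ n n _ n])
        (rule eq_matI; simp add: right_diff_distrib del: index_mult_mat(1))
  next
    fix x assume "x \<in> carrier (sl TYPE('a) n)"
    then show "bracket (sl TYPE('a) n) x x = \<zero>\<^bsub>sl TYPE('a) n\<^esub>"
      by (auto simp del: index_mult_mat(1))
  qed
qed

end

theory Submission
  imports Defs
begin

text \<open>
  In characteristic 2 one has \<open>[A\<^sup>2, B] = [A, [A, B]]\<close>. Hence the normalizer of a Lie subalgebra
  \<open>L\<close> of \<open>sl\<^sub>n\<close> inside all matrices is closed not only under sums and commutators but also under
  squares. It contains \<open>L\<close>. So if a set \<open>{x, y}\<close> produces every elementary matrix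
  \<open>E\<^sub>a\<^sub>b\<close> with \<open>a \<noteq> b\<close> by sums, commutators and squares, then \<open>L \<supseteq> {x, y}\<close> is normalized by all of
  them, and for \<open>n \<ge> 3\<close> one elementary matrix \<open>E\<^sub>c\<^sub>d\<close>, \<open>c \<noteq> d\<close>, in \<open>L\<close> is enough to force \<open>L = sl\<^sub>n\<close>. This is the content of
  \<open>restricted_lie_mat_normalizer\<close>, \<open>elementary_mem_of_ideal\<close> and \<open>two_generated_sl_of_restricted\<close>.

  Squares make idempotents available, and that is what makes a choice of generators with entries
  0 and 1 work over every field of characteristic 2. For \<open>n \<ge> 5\<close>, with indices from 0, take
  \<open>x = E\<^sub>0\<^sub>0 + E\<^sub>1\<^sub>1 + E\<^sub>p\<^sub>q\<close> where \<open>p = n - 2\<close> and \<open>q = n - 1\<close>, and let \<open>y\<close> be the matrix of the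
  \<open>n\<close>-cycle. Since \<open>p > 1\<close>, the square of \<open>x\<close> is the projection \<open>E\<^sub>0\<^sub>0 + E\<^sub>1\<^sub>1\<close>, which splits \<open>x\<close> into
  its diagonal and its nilpotent part, and splits \<open>y\<close> into the two arrows of the cycle that enter
  or leave \<open>{0, 1}\<close> and the remaining arrows. From \<open>E\<^sub>p\<^sub>q\<close> and these two parts of \<open>y\<close> one
  obtains a second projection, \<open>E\<^sub>2\<^sub>2 + E\<^sub>3\<^sub>3\<close>, which separates the two arrows, and then
  all \<open>E\<^sub>a\<^sub>b\<close> (\<open>elementary_mem_of_cycle\<close>). For \<open>n = 3\<close> a transvection \<open>x\<close> on two coordinates
  does the same (\<open>elementary_mem_of_dimension_3\<close>), and \<open>sl\<^sub>1 = 0\<close>.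

  All matrices in these computations have entries 0 and 1. They are written as binary
  relations on indices, so that addition becomes exclusive disjunction, multiplication by a
  partial injection becomes composition of relations, and the matrix identities become statements
  about indices.
\<close>

section \<open>Commutators and normalizers\<close>

definition commutator :: "'a :: ring mat \<Rightarrow> 'a mat \<Rightarrow> 'a mat" where
  "commutator A B = A * B - B * A"

definition lie_normalizer :: "nat \<Rightarrow> 'a :: ring mat set \<Rightarrow> 'a mat set" where
  "lie_normalizer n L = {A \<in> carrier_mat n n. \<forall>B\<in>L. commutator A B \<in> L}"

lemma commutator_carrier [simp]:
  "A \<in> carrier_mat n n \<Longrightarrow> B \<in> carrier_mat n n \<Longrightarrow> commutator A B \<in> carrier_mat n n"
  by (auto simp: commutator_def intro!: minus_carrier_mat mult_carrier_mat)

lemma add_self_CHAR_2: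
  assumes "CHAR('a :: ring_1) = 2"
  shows "x + x = (0 :: 'a)"
  by (metis assms diff_self minus_CHAR_2)

lemma commutator_add_left:
  fixes A B C :: "'a :: comm_ring_1 mat"
  assumes [simp]: "A \<in> carrier_mat n n" "B \<in> carrier_mat n n" "C \<in> carrier_mat n n"
  shows "commutator (A + B) C = commutator A C + commutator B C"
proof -
  have [simp]: "dim_row A = n" "dim_col A = n" "dim_row B = n" "dim_col B = n"
    "dim_row C = n" "dim_col C = n"
    using assms by (auto simp only: carrier_matD)
  show ?thesis
    unfolding commutator_def
    by (simp add: add_mult_distrib_mat[of _ n n _ _ n] mult_add_distrib_mat[of _ n n _ n])
      (rule eq_matI; simp del: index_mult_mat(1))
qed

text \<open>The Jacobi identity, in the form that makes normalizers closed under commutators.\<close>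

lemma commutator_derivation:
  fixes A B C :: "'a :: comm_ring_1 mat"
  assumes [simp]: "A \<in> carrier_mat n n" "B \<in> carrier_mat n n" "C \<in> carrier_mat n n"
  shows "commutator (commutator A B) C =
    commutator A (commutator B C) - commutator B (commutator A C)"
proof -
  have [simp]: "dim_row A = n" "dim_col A = n" "dim_row B = n" "dim_col B = n"
    "dim_row C = n" "dim_col C = n"
    using assms by (auto simp only: carrier_matD)
  show ?thesis
    unfolding commutator_def
    by (simp add: mult_minus_distrib_mat[of _ n n _ n] minus_mult_distrib_mat[of _ n n _ _ n]
        assoc_mult_mat[of _ n n _ n _ n] mult_carrier_mat[of _ n n _ n] minus_carrier_mat)
      (rule eq_matI; simp del: index_mult_mat(1))
qed

text \<open>The mixed term of \<open>A (A B - B A) - (A B - B A) A\<close> is \<open>- 2 A B A\<close>.\<close>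

lemma commutator_square:
  fixes A B :: "'a :: comm_ring_1 mat"
  assumes "CHAR('a) = 2"
    and [simp]: "A \<in> carrier_mat n n" "B \<in> carrier_mat n n"
  shows "commutator (A * A) B = commutator A (commutator A B)"
proof -
  have [simp]: "dim_row A = n" "dim_col A = n" "dim_row B = n" "dim_col B = n"
    using assms by (auto simp only: carrier_matD)
  show ?thesis
    unfolding commutator_def
    by (simp add: mult_minus_distrib_mat[of _ n n _ n] minus_mult_distrib_mat[of _ n n _ _ n]
        assoc_mult_mat[of _ n n _ n _ n] mult_carrier_mat[of _ n n _ n] minus_carrier_mat)
      (rule eq_matI; use add_self_CHAR_2[OF assms(1)] in \<open>simp del: index_mult_mat(1)\<close>)
qed

section \<open>Matrices with entries 0 and 1\<close>

definition pattern_mat :: "nat \<Rightarrow> (nat \<Rightarrow> nat \<Rightarrow> bool) \<Rightarrow> 'a :: zero_neq_one mat" where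
  "pattern_mat n R = mat n n (\<lambda>(i, j). of_bool (R i j))"

abbreviation elementary_mat :: "nat \<Rightarrow> nat \<Rightarrow> nat \<Rightarrow> 'a :: zero_neq_one mat" where
  "elementary_mat n a b \<equiv> pattern_mat n (\<lambda>i j. i = a \<and> j = b)"

abbreviation coordinate_projection :: "nat \<Rightarrow> nat set \<Rightarrow> 'a :: zero_neq_one mat" where
  "coordinate_projection n S \<equiv> pattern_mat n (\<lambda>i j. i = j \<and> i \<in> S)"

text \<open>A factor of this kind contributes at most one nonzero summand to each entry of a matrix
  product, so that the product has entries 0 and 1 again.\<close>

definition partial_injection :: "('b \<Rightarrow> 'c \<Rightarrow> bool) \<Rightarrow> bool" where
  "partial_injection R \<longleftrightarrow>
     (\<forall>i j k. R i j \<longrightarrow> R i k \<longrightarrow> j = k) \<and> (\<forall>i j k. R i k \<longrightarrow> R j k \<longrightarrow> i = j)"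

lemma partial_injection_elementary [simp]:
  "partial_injection (\<lambda>i j. i = a \<and> j = b)"
  by (simp add: partial_injection_def)

lemma partial_injection_pair:
  "a \<noteq> c \<Longrightarrow> b \<noteq> d \<Longrightarrow> partial_injection (\<lambda>i j. i = a \<and> j = b \<or> i = c \<and> j = d)"
  by (auto simp: partial_injection_def)

lemma partial_injection_diagonal [simp]:
  "partial_injection (\<lambda>i j. i = j \<and> i \<in> S)"
  by (simp add: partial_injection_def)

lemma pattern_mat_carrier [simp]: "pattern_mat n R \<in> carrier_mat n n"
  by (simp add: pattern_mat_def)

lemma pattern_mat_dim [simp]:
  "dim_row (pattern_mat n R) = n" "dim_col (pattern_mat n R) = n"
  by (simp_all add: pattern_mat_def)

lemma pattern_mat_index [simp]:
  "i < n \<Longrightarrow> j < n \<Longrightarrow> pattern_mat n R $$ (i, j) = of_bool (R i j)"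
  by (simp add: pattern_mat_def)

lemma pattern_mat_cong:
  assumes "\<And>i j. i < n \<Longrightarrow> j < n \<Longrightarrow> R i j = T i j"
  shows "pattern_mat n R = pattern_mat n T"
  using assms by (intro eq_matI) auto

lemma pattern_mat_mult:
  assumes "\<And>i j k l. R i k \<Longrightarrow> T k j \<Longrightarrow> R i l \<Longrightarrow> T l j \<Longrightarrow> k = l"
  shows "pattern_mat n R * pattern_mat n T =
    (pattern_mat n (\<lambda>i j. \<exists>k<n. R i k \<and> T k j) :: 'a :: comm_ring_1 mat)"
proof (rule eq_matI)
  fix i j
  assume "i < dim_row (pattern_mat n (\<lambda>i j. \<exists>k<n. R i k \<and> T k j) :: 'a mat)"
    and "j < dim_col (pattern_mat n (\<lambda>i j. \<exists>k<n. R i k \<and> T k j) :: 'a mat)"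
  then have ij: "i < n" "j < n"
    by simp_all
  have "(pattern_mat n R * pattern_mat n T) $$ (i, j) =
      (\<Sum>k<n. of_bool (R i k \<and> T k j) :: 'a)"
    using ij by (auto simp: scalar_prod_def lessThan_atLeast0 of_bool_conj intro!: sum.cong)
  also have "\<dots> = of_bool (\<exists>k<n. R i k \<and> T k j)"
  proof (cases "\<exists>k<n. R i k \<and> T k j")
    case True
    then obtain k where k: "k < n" "R i k" "T k j"
      by blast
    then have iff: "R i l \<and> T l j \<longleftrightarrow> l = k" for l
      using assms by metis
    have "(\<Sum>l<n. of_bool (R i l \<and> T l j) :: 'a) = (\<Sum>l<n. if l = k then 1 else 0)"
      using iff by simp
    then show ?thesis
      using k True by simp
  next
    case False
    then have "(\<Sum>k<n. of_bool (R i k \<and> T k j) :: 'a) = (\<Sum>k<n. 0)"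
      by (intro sum.cong) auto
    then show ?thesis
      using False by simp
  qed
  finally show "(pattern_mat n R * pattern_mat n T) $$ (i, j) =
      (pattern_mat n (\<lambda>i j. \<exists>k<n. R i k \<and> T k j) :: 'a mat) $$ (i, j)"
    using ij by simp
qed simp_all

lemma pattern_mat_in_sl:
  assumes "CHAR('a :: field) = 2" and "\<And>i. i < n \<Longrightarrow> R i i \<longleftrightarrow> i \<in> S" "S \<subseteq> {..<n}" "even (card S)"
  shows "pattern_mat n R \<in> carrier (sl TYPE('a) n)"
proof -
  have "mat_trace (pattern_mat n R :: 'a mat) = of_nat (card {i. i < n \<and> R i i})"
    by (simp add: mat_trace_def lessThan_def Collect_conj_eq)
  also have "{i. i < n \<and> R i i} = S"
    using assms(2,3) by blast
  also have "of_nat (card S) = (0 :: 'a)"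
    using assms(1,4) by (simp add: of_nat_eq_0_iff_char_dvd)
  finally show ?thesis
    by simp
qed

lemma of_bool_add_CHAR_2:
  assumes "CHAR('a :: ring_1) = 2"
  shows "of_bool P + of_bool Q = (of_bool (P \<noteq> Q) :: 'a)"
  using add_self_CHAR_2[OF assms, of 1] by auto

lemma of_bool_diff_CHAR_2:
  assumes "CHAR('a :: ring_1) = 2"
  shows "of_bool P - of_bool Q = (of_bool (P \<noteq> Q) :: 'a)"
  using of_bool_add_CHAR_2[OF assms] by (simp add: minus_CHAR_2[OF assms])

lemma pattern_mat_add:
  assumes "CHAR('a :: comm_ring_1) = 2"
  shows "pattern_mat n R + pattern_mat n T = (pattern_mat n (\<lambda>i j. R i j \<noteq> T i j) :: 'a mat)"
  using of_bool_add_CHAR_2[OF assms] by (intro eq_matI) auto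

lemma commutator_pattern_mat:
  assumes "CHAR('a :: comm_ring_1) = 2" and "partial_injection R"
  shows "commutator (pattern_mat n R) (pattern_mat n T) =
    (pattern_mat n (\<lambda>i j. (\<exists>k<n. R i k \<and> T k j) \<noteq> (\<exists>k<n. T i k \<and> R k j)) :: 'a mat)"
proof -
  have "pattern_mat n R * pattern_mat n T =
      (pattern_mat n (\<lambda>i j. \<exists>k<n. R i k \<and> T k j) :: 'a mat)"
    and "pattern_mat n T * pattern_mat n R =
      (pattern_mat n (\<lambda>i j. \<exists>k<n. T i k \<and> R k j) :: 'a mat)"
    using assms(2) by (auto intro!: pattern_mat_mult simp: partial_injection_def)
  then show ?thesis
    unfolding commutator_def
    using of_bool_diff_CHAR_2[OF assms(1)] by (intro eq_matI) auto
qed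

section \<open>Generating elementary matrices by commutators and squares\<close>

text \<open>In characteristic 2, squaring is the \<open>p\<close>-operation that makes matrices under the commutator a
  restricted Lie algebra. The sets below are its restricted subalgebras over the prime field.\<close>

locale restricted_lie_mat =
  fixes Z :: "'a :: field mat set"
  assumes CHAR_2: "CHAR('a) = 2"
    and add_closed: "\<And>A B. A \<in> Z \<Longrightarrow> B \<in> Z \<Longrightarrow> A + B \<in> Z"
    and commutator_closed: "\<And>A B. A \<in> Z \<Longrightarrow> B \<in> Z \<Longrightarrow> commutator A B \<in> Z"
    and square_closed: "\<And>A. A \<in> Z \<Longrightarrow> A * A \<in> Z"
begin

lemma pattern_add_mem:
  assumes "pattern_mat n R \<in> Z" "pattern_mat n T \<in> Z"
    and "\<And>i j. i < n \<Longrightarrow> j < n \<Longrightarrow> U i j \<longleftrightarrow> R i j \<noteq> T i j"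
  shows "pattern_mat n U \<in> Z"
proof -
  have "pattern_mat n U = (pattern_mat n R + pattern_mat n T :: 'a mat)"
    unfolding pattern_mat_add[OF CHAR_2] using assms(3) by (rule pattern_mat_cong)
  then show ?thesis
    using add_closed[OF assms(1,2)] by simp
qed

lemma pattern_commutator_mem:
  assumes "pattern_mat n R \<in> Z" "pattern_mat n T \<in> Z" and "partial_injection R"
    and "\<And>i j. i < n \<Longrightarrow> j < n \<Longrightarrow>
      U i j \<longleftrightarrow> (\<exists>k<n. R i k \<and> T k j) \<noteq> (\<exists>k<n. T i k \<and> R k j)"
  shows "pattern_mat n U \<in> Z"
proof -
  have "pattern_mat n U = (commutator (pattern_mat n R) (pattern_mat n T) :: 'a mat)"
    unfolding commutator_pattern_mat[OF CHAR_2 assms(3)] using assms(4) by (rule pattern_mat_cong)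
  then show ?thesis
    using commutator_closed[OF assms(1,2)] by simp
qed

lemma elementary_pair_commutator_mem:
  assumes "pattern_mat n (\<lambda>i j. i = a \<and> j = b \<or> i = c \<and> j = d) \<in> Z" "pattern_mat n T \<in> Z"
    and "a \<noteq> c" "b \<noteq> d" "a < n" "b < n" "c < n" "d < n"
    and "\<And>i j. i < n \<Longrightarrow> j < n \<Longrightarrow>
      U i j \<longleftrightarrow> (i = a \<and> T b j \<or> i = c \<and> T d j) \<noteq> (T i a \<and> j = b \<or> T i c \<and> j = d)"
  shows "pattern_mat n U \<in> Z"
proof (rule pattern_commutator_mem[OF assms(1,2) partial_injection_pair[OF assms(3,4)]])
  fix i j
  assume ij: "i < n" "j < n"
  have "(\<exists>k<n. (i = a \<and> k = b \<or> i = c \<and> k = d) \<and> T k j) \<longleftrightarrow> i = a \<and> T b j \<or> i = c \<and> T d j"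
    and "(\<exists>k<n. T i k \<and> (k = a \<and> j = b \<or> k = c \<and> j = d)) \<longleftrightarrow> T i a \<and> j = b \<or> T i c \<and> j = d"
    using assms(5-8) by blast+
  then show "U i j \<longleftrightarrow> (\<exists>k<n. (i = a \<and> k = b \<or> i = c \<and> k = d) \<and> T k j) \<noteq>
      (\<exists>k<n. T i k \<and> (k = a \<and> j = b \<or> k = c \<and> j = d))"
    using assms(9)[OF ij] by simp
qed

lemma elementary_commutator_mem:
  assumes "elementary_mat n a b \<in> Z" "elementary_mat n b c \<in> Z"
    and "a \<noteq> c" "b < n"
  shows "elementary_mat n a c \<in> Z"
proof (rule pattern_commutator_mem[OF assms(1,2)])
qed (use assms(3,4) in auto)

text \<open>The commutator with the projection to the coordinates in \<open>S\<close> annihilates the entries that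
  stay inside \<open>S\<close> or inside its complement, and in characteristic 2 it fixes all the others.
  Hence \<open>Z\<close> contains both parts of a matrix separately.\<close>

lemma coordinate_projection_split:
  assumes "coordinate_projection n S \<in> Z" and "pattern_mat n R \<in> Z"
    and "\<And>i j. i < n \<Longrightarrow> j < n \<Longrightarrow> U i j \<longleftrightarrow> R i j \<and> (i \<in> S) \<noteq> (j \<in> S)"
  shows "pattern_mat n U \<in> Z"
proof (rule pattern_commutator_mem[OF assms(1,2)])
  show "U i j \<longleftrightarrow> (\<exists>k<n. (i = k \<and> i \<in> S) \<and> R k j) \<noteq> (\<exists>k<n. R i k \<and> k = j \<and> k \<in> S)"
    if "i < n" "j < n" for i j
    unfolding assms(3)[OF that] using that by blast
qed simp


text \<open>The first matrix is idempotent plus nilpotent, the second is the matrix of the \<open>n\<close>-cycle. The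
  bound \<open>3 \<le> p\<close> keeps the index 3 different from \<open>q\<close>, which the projection to \<open>{2, 3}\<close> needs
  in order to separate \<open>E\<^sub>2\<^sub>0\<close> from \<open>E\<^sub>1\<^sub>q\<close> and \<open>E\<^sub>1\<^sub>2\<close> from \<open>E\<^sub>q\<^sub>0\<close>.\<close>

lemma elementary_mem_of_cycle:
  assumes n: "n = Suc q" "q = Suc p" "3 \<le> p"
    and x: "pattern_mat n (\<lambda>i j. i = j \<and> i < 2 \<or> i = p \<and> j = q) \<in> Z"
    and y: "pattern_mat n (\<lambda>i j. j = Suc i \<or> i = q \<and> j = 0) \<in> Z"
    and ab: "a < n" "b < n" "a \<noteq> b"
  shows "elementary_mat n a b \<in> Z"
proof -
  have "pattern_mat n (\<lambda>i j. i = j \<and> i < 2 \<or> i = p \<and> j = q) *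
      pattern_mat n (\<lambda>i j. i = j \<and> i < 2 \<or> i = p \<and> j = q) =
      (coordinate_projection n {0, 1} :: 'a mat)"
    by (subst pattern_mat_mult) (use n in \<open>auto intro!: pattern_mat_cong\<close>)
  with square_closed[OF x] have D01: "coordinate_projection n {0, 1} \<in> Z"
    by simp
  have Epq: "elementary_mat n p q \<in> Z"
    by (rule pattern_add_mem[OF x D01]) (use n in auto)
  \<comment> \<open>the two arrows of the cycle between \<open>{0, 1}\<close> and the rest; \<open>Q\<close> below collects the other arrows\<close>
  have c: "pattern_mat n (\<lambda>i j. i = q \<and> j = 0 \<or> i = 1 \<and> j = 2) \<in> Z"
    by (rule coordinate_projection_split[OF D01 y]) (use n in auto)
  have Q: "pattern_mat n (\<lambda>i j. j = Suc i \<and> i \<noteq> 1) \<in> Z"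
    by (rule pattern_add_mem[OF y c]) (use n in auto)
  \<comment> \<open>\<open>Q\<close> has no arrow out of \<open>q\<close>, so commuting \<open>E\<^sub>k\<^sub>q\<close> with it only moves \<open>k\<close> backwards, until the
     missing arrow from 1 to 2 stops the descent\<close>
  have Ekq: "elementary_mat n k q \<in> Z" if "2 \<le> k" "k \<le> p" for k
    using that(2,1)
  proof (induction rule: inc_induct)
    case base
    show ?case
      by (rule Epq)
  next
    case (step m)
    then have "elementary_mat n (Suc m) q \<in> Z"
      by simp
    then show ?case
      by (rule pattern_commutator_mem[OF _ Q]) (use n step in auto)
  qed
  have Ek0: "elementary_mat n k 0 \<in> Z" if "3 \<le> k" "k \<le> p" for k
    by (rule pattern_commutator_mem[OF Ekq c, of k]) (use n that in auto)
  \<comment> \<open>near the arrow from 1 to 2 only sums of two elementary matrices appear; they end in the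
     projection to \<open>{0, 1, 2, 3}\<close>, which is what pulls them apart\<close>
  have E20_E1q: "pattern_mat n (\<lambda>i j. i = 2 \<and> j = 0 \<or> i = 1 \<and> j = q) \<in> Z"
    by (rule pattern_commutator_mem[OF Ekq c, of 2]) (use n in auto)
  have E31_E20: "pattern_mat n (\<lambda>i j. i = 3 \<and> j = 1 \<or> i = 2 \<and> j = 0) \<in> Z"
    by (rule pattern_commutator_mem[OF Ek0 Q, of 3]) (use n in auto)
  have E32_E10: "pattern_mat n (\<lambda>i j. i = 3 \<and> j = 2 \<or> i = 1 \<and> j = 0) \<in> Z"
    by (rule elementary_pair_commutator_mem[OF E31_E20 c]) (use n in auto)
  have D0123: "coordinate_projection n {0, 1, 2, 3} \<in> Z"
    by (rule elementary_pair_commutator_mem[OF E32_E10 Q]) (use n in auto)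
  have D23: "coordinate_projection n {2, 3} \<in> Z"
    by (rule pattern_add_mem[OF D0123 D01]) auto
  have E20: "elementary_mat n 2 0 \<in> Z"
    by (rule coordinate_projection_split[OF D23 E20_E1q]) (use n in auto)
  have E1q: "elementary_mat n 1 q \<in> Z"
    by (rule pattern_add_mem[OF E20_E1q E20]) auto
  have E12: "elementary_mat n 1 2 \<in> Z"
    by (rule coordinate_projection_split[OF D23 c]) (use n in auto)
  have Eq0: "elementary_mat n q 0 \<in> Z"
    by (rule pattern_add_mem[OF c E12]) auto
  have Eq1_Ep0: "pattern_mat n (\<lambda>i j. i = q \<and> j = 1 \<or> i = p \<and> j = 0) \<in> Z"
    by (rule pattern_commutator_mem[OF Eq0 Q]) (use n in auto)
  have Eq1: "elementary_mat n q 1 \<in> Z"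
    by (rule pattern_add_mem[OF Eq1_Ep0 Ek0, of p]) (use n in auto)
  \<comment> \<open>a projection that meets only two arrows of \<open>Q\<close>, one of which is the known \<open>E\<^sub>p\<^sub>q\<close>\<close>
  have D1q: "coordinate_projection n {1, q} \<in> Z"
    by (rule pattern_commutator_mem[OF E1q Eq1]) (use n in auto)
  have E01_Epq: "pattern_mat n (\<lambda>i j. i = 0 \<and> j = 1 \<or> i = p \<and> j = q) \<in> Z"
    by (rule coordinate_projection_split[OF D1q Q]) (use n in auto)
  have E01: "elementary_mat n 0 1 \<in> Z"
    by (rule pattern_add_mem[OF E01_Epq Epq]) (use n in auto)
  \<comment> \<open>with the whole row and the whole column of index \<open>q\<close>, every \<open>E\<^sub>a\<^sub>b\<close> is \<open>[E\<^sub>a\<^sub>q, E\<^sub>q\<^sub>b]\<close>\<close>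
  have row: "elementary_mat n q k \<in> Z" if "k < q" for k
    using that
  proof (induction k)
    case 0
    show ?case
      by (rule Eq0)
  next
    case (Suc k)
    then have Eqk: "elementary_mat n q k \<in> Z"
      by simp
    consider "k = 0" | "k = 1" | "2 \<le> k"
      by linarith
    then show ?case
    proof cases
      case 1
      then show ?thesis
        using Eq1 by simp
    next
      case 2
      have "elementary_mat n q 2 \<in> Z"
        by (rule elementary_commutator_mem[OF Eq1 E12]) (use n in auto)
      then show ?thesis
        using 2 by (simp add: numeral_2_eq_2)
    next
      case 3
      have sum: "pattern_mat n (\<lambda>i j. i = q \<and> j = Suc k \<or> i = p \<and> j = k) \<in> Z"
        by (rule pattern_commutator_mem[OF Eqk Q]) (use n 3 Suc.prems in auto)
      have Epk: "elementary_mat n p k \<in> Z"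
        by (rule elementary_commutator_mem[OF Epq Eqk]) (use n Suc.prems in auto)
      show ?thesis
        by (rule pattern_add_mem[OF sum Epk]) (use n in auto)
    qed
  qed
  have col: "elementary_mat n k q \<in> Z" if "k < q" for k
  proof -
    consider "k = 0" | "k = 1" | "2 \<le> k"
      by linarith
    then show ?thesis
    proof cases
      case 1
      show ?thesis
        unfolding 1 by (rule elementary_commutator_mem[OF E01 E1q]) (use n in auto)
    next
      case 2
      then show ?thesis
        using E1q by simp
    next
      case 3
      then show ?thesis
        using Ekq that n by simp
    qed
  qed
  show ?thesis
  proof (cases "a = q \<or> b = q")
    case True
    then show ?thesis
      using row[of b] col[of a] ab n by auto
  next
    case False
    then show ?thesis
      using elementary_commutator_mem[OF col row, of a b] ab n by simp
  qed
qed

text \<open>Here the projection \<open>E\<^sub>0\<^sub>0 + E\<^sub>1\<^sub>1\<close> is the square of the transvection \<open>E\<^sub>0\<^sub>0 + E\<^sub>1\<^sub>1 + E\<^sub>0\<^sub>1\<close>, because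
  the off-diagonal entry of the square is \<open>1 + 1\<close>. It cuts \<open>E\<^sub>1\<^sub>0\<close> off the second matrix; with
  \<open>E\<^sub>0\<^sub>1\<close> and \<open>E\<^sub>1\<^sub>0\<close> at hand, \<open>E\<^sub>0\<^sub>2 + E\<^sub>2\<^sub>0\<close> decomposes.\<close>

lemma elementary_mem_of_dimension_3:
  assumes n: "n = 3"
    and x: "pattern_mat n (\<lambda>i j. i = j \<and> i < 2 \<or> i = 0 \<and> j = 1) \<in> Z"
    and y: "pattern_mat n (\<lambda>i j. i = 1 \<and> j = 0 \<or> i = 0 \<and> j = 2 \<or> i = 2 \<and> j = 0) \<in> Z"
    and ab: "a < n" "b < n" "a \<noteq> b"
  shows "elementary_mat n a b \<in> Z"
proof -
  have "pattern_mat n (\<lambda>i j. i = j \<and> i < 2 \<or> i = 0 \<and> j = 1) *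
      pattern_mat n (\<lambda>i j. i = j \<and> i < 2 \<or> i = 0 \<and> j = 1) =
      (coordinate_projection n {0, 1} :: 'a mat)"
    using add_self_CHAR_2[OF CHAR_2, of 1] n
    by (intro eq_matI) (auto simp: scalar_prod_def numeral_3_eq_3 less_Suc_eq)
  with square_closed[OF x] have D01: "coordinate_projection n {0, 1} \<in> Z"
    by simp
  have E01: "elementary_mat n 0 1 \<in> Z"
    by (rule pattern_add_mem[OF x D01]) auto
  have c: "pattern_mat n (\<lambda>i j. i = 0 \<and> j = 2 \<or> i = 2 \<and> j = 0) \<in> Z"
    by (rule coordinate_projection_split[OF D01 y]) auto
  have E10: "elementary_mat n 1 0 \<in> Z"
    by (rule pattern_add_mem[OF y c]) auto
  have E21: "elementary_mat n 2 1 \<in> Z"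
    by (rule pattern_commutator_mem[OF E01 c]) (use n in auto)
  have E20: "elementary_mat n 2 0 \<in> Z"
    by (rule elementary_commutator_mem[OF E21 E10]) (use n in auto)
  have E02: "elementary_mat n 0 2 \<in> Z"
    by (rule pattern_add_mem[OF c E20]) auto
  have E12: "elementary_mat n 1 2 \<in> Z"
    by (rule elementary_commutator_mem[OF E10 E02]) (use n in auto)
  have "a \<in> {0, 1, 2}" "b \<in> {0, 1, 2}"
    using ab n by auto
  then show ?thesis
    using ab(3) E01 E02 E10 E12 E20 E21 by auto
qed

end


section \<open>Back to Lie subalgebras of traceless matrices\<close>

lemma lie_subalgebra_slD:
  fixes L :: "'a :: field mat set"
  assumes "lie_subalgebra L (class_ring :: 'a ring) (sl TYPE('a) n)"
  shows "L \<subseteq> carrier_mat n n"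
    and "0\<^sub>m n n \<in> L"
    and "\<And>A B. A \<in> L \<Longrightarrow> B \<in> L \<Longrightarrow> A + B \<in> L"
    and "\<And>c A. A \<in> L \<Longrightarrow> c \<cdot>\<^sub>m A \<in> L"
    and "\<And>A B. A \<in> L \<Longrightarrow> B \<in> L \<Longrightarrow> commutator A B \<in> L"
proof -
  interpret lie_algebra "class_ring :: 'a ring" "sl TYPE('a) n"
    by (rule lie_algebra_sl)
  have sub: "Module.submodule L (class_ring :: 'a ring) (sl TYPE('a) n)"
    using assms by (simp add: lie_subalgebra_def)
  show "L \<subseteq> carrier_mat n n"
    using submoduleE(1)[OF sub] by auto
  show "0\<^sub>m n n \<in> L"
    using subgroup.one_closed[OF submodule.axioms(1)[OF sub]] by simp
  show "A + B \<in> L" if "A \<in> L" "B \<in> L" for A B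
    using submoduleE(5)[OF sub that] by simp
  show "c \<cdot>\<^sub>m A \<in> L" if "A \<in> L" for c A
    using submoduleE(4)[OF sub _ that, of c] by simp
  show "commutator A B \<in> L" if "A \<in> L" "B \<in> L" for A B
    using assms that by (simp add: lie_subalgebra_def commutator_def)
qed

lemma restricted_lie_mat_normalizer:
  fixes L :: "'a :: field mat set"
  assumes CHAR_2: "CHAR('a) = 2"
    and L: "lie_subalgebra L (class_ring :: 'a ring) (sl TYPE('a) n)"
  shows "restricted_lie_mat (lie_normalizer n L)"
proof
  note L_carrier = subsetD[OF lie_subalgebra_slD(1)[OF L]]
  note L_add = lie_subalgebra_slD(3)[OF L]
  have L_diff: "A - B \<in> L" if "A \<in> L" "B \<in> L" for A B
  proof -
    have "A - B = A + (-1) \<cdot>\<^sub>m B"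
      using L_carrier[OF that(1)] L_carrier[OF that(2)] by (intro eq_matI) auto
    then show ?thesis
      using L_add[OF that(1) lie_subalgebra_slD(4)[OF L that(2)]] by simp
  qed
  show "CHAR('a) = 2"
    by (rule CHAR_2)
  fix A B
  assume A: "A \<in> lie_normalizer n L"
  then show "A * A \<in> lie_normalizer n L"
    using L_carrier commutator_square[OF CHAR_2, of A n] by (auto simp: lie_normalizer_def)
  assume B: "B \<in> lie_normalizer n L"
  from A B show "A + B \<in> lie_normalizer n L"
    using L_carrier L_add commutator_add_left[of A n B] by (auto simp: lie_normalizer_def)
  from A B show "commutator A B \<in> lie_normalizer n L"
    using L_carrier L_diff commutator_derivation[of A n B] by (auto simp: lie_normalizer_def)
qed

text \<open>Commutators with elementary matrices change one index of \<open>E\<^sub>c\<^sub>d\<close> at a time. A third index \<open>k\<close>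
  serves as an intermediate column, since going through \<open>E\<^sub>a\<^sub>d\<close> would fail for \<open>a = d\<close>.\<close>

lemma elementary_mem_of_ideal:
  fixes L :: "'a :: field mat set"
  assumes CHAR_2: "CHAR('a) = 2" and n: "3 \<le> n"
    and ideal: "\<And>a b. a < n \<Longrightarrow> b < n \<Longrightarrow> a \<noteq> b \<Longrightarrow> elementary_mat n a b \<in> lie_normalizer n L"
    and cd: "elementary_mat n c d \<in> L" "c < n" "d < n" "c \<noteq> d"
    and ab: "a < n" "b < n" "a \<noteq> b"
  shows "elementary_mat n a b \<in> L"
proof -
  have mem: "pattern_mat n U \<in> L"
    if "elementary_mat n a b \<in> L" "c < n" "d < n" "c \<noteq> d"
      and "pattern_mat n U = (commutator (elementary_mat n c d) (elementary_mat n a b) :: 'a mat)"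
    for a b c d U
    using ideal[of c d] that by (simp add: lie_normalizer_def)
  have row: "elementary_mat n e b \<in> L"
    if "elementary_mat n a b \<in> L" "a < n" "e < n" "b < n" "e \<noteq> b" "a \<noteq> b" for a b e
  proof (cases "e = a")
    case False
    show ?thesis
      by (rule mem[OF that(1), of e a], unfold commutator_pattern_mat[OF CHAR_2 partial_injection_elementary])
        (use that False in \<open>auto intro!: pattern_mat_cong\<close>)
  qed (use that in simp)
  have col: "elementary_mat n a e \<in> L"
    if "elementary_mat n a b \<in> L" "a < n" "e < n" "b < n" "e \<noteq> a" "a \<noteq> b" for a b e
  proof (cases "e = b")
    case False
    show ?thesis
      by (rule mem[OF that(1), of b e], unfold commutator_pattern_mat[OF CHAR_2 partial_injection_elementary])
        (use that False in \<open>auto intro!: pattern_mat_cong\<close>)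
  qed (use that in simp)
  have "\<exists>k<n. k \<noteq> c \<and> k \<noteq> a"
  proof -
    have "\<not> {..<n} \<subseteq> {c, a}"
      using card_mono[of "{c, a}" "{..<n}"] card_insert_le_m1[of 2 "{a}" c] n by auto
    then show ?thesis
      by auto
  qed
  then obtain k where k: "k < n" "k \<noteq> c" "k \<noteq> a"
    by blast
  have "elementary_mat n c k \<in> L"
    using col[OF cd(1)] cd k by simp
  then have "elementary_mat n a k \<in> L"
    using row cd k ab by simp
  then show ?thesis
    using col k ab by simp
qed

text \<open>The off-diagonal part of \<open>A\<close> is a sum of multiples of elementary matrices. The diagonal part is
  built from multiples of \<open>[E\<^sub>k\<^sub>l, E\<^sub>l\<^sub>k]\<close> with \<open>l = k + 1\<close>, which carry the partial sums of the diagonal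
  from one position to the next; the last position comes out right because the trace of \<open>A\<close>
  vanishes.\<close>

lemma sl_subset_of_elementary:
  fixes L :: "'a :: field mat set"
  assumes CHAR_2: "CHAR('a) = 2"
    and L: "lie_subalgebra L (class_ring :: 'a ring) (sl TYPE('a) n)"
    and elem: "\<And>a b. a < n \<Longrightarrow> b < n \<Longrightarrow> a \<noteq> b \<Longrightarrow> elementary_mat n a b \<in> L"
    and A: "A \<in> carrier (sl TYPE('a) n)"
  shows "A \<in> L"
proof (cases "n = 0")
  case True
  then have "A = 0\<^sub>m n n"
    using A by auto
  then show ?thesis
    using lie_subalgebra_slD(2)[OF L] by simp
next
  case False
  note L_zero = lie_subalgebra_slD(2)[OF L]
  note L_add = lie_subalgebra_slD(3)[OF L]
  note L_smult = lie_subalgebra_slD(4)[OF L]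
  have A_carrier: "A \<in> carrier_mat n n" and "mat_trace A = 0"
    using A by auto
  then have trace: "(\<Sum>i<n. A $$ (i, i)) = 0"
    by (simp add: mat_trace_def)
  have off: "mat n n (\<lambda>ij. if ij \<in> S then A $$ ij else 0) \<in> L"
    if "finite S" "S \<subseteq> {(i, j). i < n \<and> j < n \<and> i \<noteq> j}" for S
    using that
  proof (induction rule: finite_induct)
    case empty
    have "mat n n (\<lambda>ij. if ij \<in> {} then A $$ ij else 0) = 0\<^sub>m n n"
      by (intro eq_matI) auto
    then show ?case
      using L_zero by simp
  next
    case (insert x S)
    obtain a b where x: "x = (a, b)" "a < n" "b < n" "a \<noteq> b"
      using insert.prems by auto
    have "mat n n (\<lambda>ij. if ij \<in> insert x S then A $$ ij else 0) =
        A $$ x \<cdot>\<^sub>m elementary_mat n a b + mat n n (\<lambda>ij. if ij \<in> S then A $$ ij else 0)"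
      using insert.hyps x by (intro eq_matI) auto
    then show ?case
      using insert elem[OF x(2-4)] L_add L_smult by simp
  qed
  have diag: "mat n n (\<lambda>(i, j). if i = j then if i < k then A $$ (i, i)
      else if i = k then \<Sum>l<k. A $$ (l, l) else 0 else 0) \<in> L"
    (is "?D k \<in> L") if "k < n" for k
    using that
  proof (induction k)
    case 0
    have "?D 0 = 0\<^sub>m n n"
      by (intro eq_matI) auto
    then show ?case
      using L_zero by simp
  next
    case (Suc k)
    have "coordinate_projection n {k, Suc k} =
        (commutator (elementary_mat n k (Suc k)) (elementary_mat n (Suc k) k) :: 'a mat)"
      unfolding commutator_pattern_mat[OF CHAR_2 partial_injection_elementary]
      using Suc.prems by (intro pattern_mat_cong) auto
    then have "coordinate_projection n {k, Suc k} \<in> L"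
      using elem[of k "Suc k"] elem[of "Suc k" k] Suc.prems lie_subalgebra_slD(5)[OF L] by simp
    moreover have "?D (Suc k) = ?D k + (\<Sum>l<Suc k. A $$ (l, l)) \<cdot>\<^sub>m coordinate_projection n {k, Suc k}"
    proof (rule eq_matI)
      fix i j
      assume "i < dim_row (?D k + (\<Sum>l<Suc k. A $$ (l, l)) \<cdot>\<^sub>m coordinate_projection n {k, Suc k})"
        and "j < dim_col (?D k + (\<Sum>l<Suc k. A $$ (l, l)) \<cdot>\<^sub>m coordinate_projection n {k, Suc k})"
      then have "i < n" "j < n"
        by simp_all
      moreover have "(2 :: 'a) = 0"
        using add_self_CHAR_2[OF CHAR_2, of 1] by simp
      ultimately show "?D (Suc k) $$ (i, j) =
          (?D k + (\<Sum>l<Suc k. A $$ (l, l)) \<cdot>\<^sub>m coordinate_projection n {k, Suc k}) $$ (i, j)"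
        by (auto simp: less_Suc_eq)
    qed simp_all
    ultimately show ?case
      using Suc L_add L_smult by simp
  qed
  have last: "A $$ (n - 1, n - 1) = (\<Sum>l<n - 1. A $$ (l, l))"
  proof -
    have "(\<Sum>l<n - 1. A $$ (l, l)) + A $$ (n - 1, n - 1) = 0"
      using trace False by (cases n) simp_all
    then show ?thesis
      by (metis CHAR_2 add_eq_0_iff uminus_CHAR_2)
  qed
  let ?S = "{(i, j). i < n \<and> j < n \<and> i \<noteq> j}"
  have "finite ?S"
    by (rule finite_subset[of _ "{..<n} \<times> {..<n}"]) auto
  then have "mat n n (\<lambda>ij. if ij \<in> ?S then A $$ ij else 0) + ?D (n - 1) \<in> L"
    using False by (intro L_add off diag) simp_all
  also have "mat n n (\<lambda>ij. if ij \<in> ?S then A $$ ij else 0) + ?D (n - 1) = A"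
    using A_carrier last False by (intro eq_matI) auto
  finally show ?thesis .
qed

lemma two_generated_slI:
  assumes CHAR_2: "CHAR('a :: field) = 2"
    and x: "x \<in> carrier (sl TYPE('a) n)" and y: "y \<in> carrier (sl TYPE('a) n)"
    and elem: "\<And>L a b. lie_subalgebra L (class_ring :: 'a ring) (sl TYPE('a) n) \<Longrightarrow>
      x \<in> L \<Longrightarrow> y \<in> L \<Longrightarrow> a < n \<Longrightarrow> b < n \<Longrightarrow> a \<noteq> b \<Longrightarrow> elementary_mat n a b \<in> L"
  shows "two_generated (class_ring :: 'a ring) (sl TYPE('a) n)"
proof -
  interpret lie_algebra "class_ring :: 'a ring" "sl TYPE('a) n"
    by (rule lie_algebra_sl)
  let ?L = "lie_generated (class_ring :: 'a ring) (sl TYPE('a) n) {x, y}"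
  have L: "lie_subalgebra ?L (class_ring :: 'a ring) (sl TYPE('a) n)"
    by (rule lie_subalgebra_lie_generated) (use x y in blast)
  have xy: "x \<in> ?L" "y \<in> ?L"
    using lie_generated_incl[of "{x, y}"] by blast+
  have "?L = carrier (sl TYPE('a) n)"
  proof
    show "?L \<subseteq> carrier (sl TYPE('a) n)"
      by (rule lie_generated_least[OF lie_subalgebra_carrier]) (use x y in blast)
    show "carrier (sl TYPE('a) n) \<subseteq> ?L"
      using sl_subset_of_elementary[OF CHAR_2 L] elem[OF L xy] by blast
  qed
  then show ?thesis
    unfolding two_generated_def using x y by blast
qed

text \<open>The condition on \<open>X\<close> says that row 2 is empty and that column 0 has its only entry on the
  diagonal. It gives \<open>[E\<^sub>0\<^sub>2, X] = E\<^sub>0\<^sub>2\<close> up to sign. As \<open>E\<^sub>0\<^sub>2\<close> normalizes \<open>L\<close> and \<open>X\<close> lies in \<open>L\<close>,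
  this places \<open>E\<^sub>0\<^sub>2\<close> in \<open>L\<close> itself.\<close>

lemma two_generated_sl_of_restricted:
  assumes CHAR_2: "CHAR('a :: field) = 2" and n: "3 \<le> n"
    and x: "pattern_mat n X \<in> carrier (sl TYPE('a) n)"
    and y: "pattern_mat n Y \<in> carrier (sl TYPE('a) n)"
    and X: "\<And>j. j < n \<Longrightarrow> \<not> X 2 j" "\<And>i. i < n \<Longrightarrow> X i 0 \<longleftrightarrow> i = 0"
    and elem: "\<And>(Z :: 'a mat set) a b. restricted_lie_mat Z \<Longrightarrow> pattern_mat n X \<in> Z \<Longrightarrow>
      pattern_mat n Y \<in> Z \<Longrightarrow> a < n \<Longrightarrow> b < n \<Longrightarrow> a \<noteq> b \<Longrightarrow> elementary_mat n a b \<in> Z"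
  shows "two_generated (class_ring :: 'a ring) (sl TYPE('a) n)"
proof (rule two_generated_slI[OF CHAR_2 x y])
  fix L :: "'a mat set" and a b
  assume L: "lie_subalgebra L (class_ring :: 'a ring) (sl TYPE('a) n)"
    and xL: "pattern_mat n X \<in> L" and yL: "pattern_mat n Y \<in> L"
    and ab: "a < n" "b < n" "a \<noteq> b"
  have "L \<subseteq> lie_normalizer n L"
    using lie_subalgebra_slD(1,5)[OF L] by (auto simp: lie_normalizer_def)
  then have ideal: "elementary_mat n a b \<in> lie_normalizer n L" if "a < n" "b < n" "a \<noteq> b" for a b
    using elem[OF restricted_lie_mat_normalizer[OF CHAR_2 L]] xL yL that by blast
  have "elementary_mat n 0 2 = (commutator (elementary_mat n 0 2) (pattern_mat n X) :: 'a mat)"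
    unfolding commutator_pattern_mat[OF CHAR_2 partial_injection_elementary]
    using n X by (intro pattern_mat_cong) auto
  then have "elementary_mat n 0 2 \<in> L"
    using ideal[of 0 2] xL n unfolding lie_normalizer_def by fastforce
  then show "elementary_mat n a b \<in> L"
    using elementary_mem_of_ideal[OF CHAR_2 n ideal _ _ _ _ ab, of 0 2] n by simp
qed

theorem proposition5p1:
  fixes n :: nat
  assumes "CHAR('a :: {field, finite}) = 2"
    and "n > 0" and "n \<noteq> 2" and "n \<noteq> 4"
  shows "two_generated (class_ring :: 'a ring) (sl TYPE('a) n)"
proof -
  consider "n = 1" | "n = 3" | "5 \<le> n"
    using assms(2-4) by linarith
  then show ?thesis
  proof cases
    case 1
    have "0\<^sub>m n n \<in> carrier (sl TYPE('a) n)"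
      by (simp add: mat_trace_def)
    then show ?thesis
      using 1 by (intro two_generated_slI[OF assms(1), of "0\<^sub>m n n" _ "0\<^sub>m n n"]) simp_all
  next
    case 2
    show ?thesis
    proof (rule two_generated_sl_of_restricted[OF assms(1)])
      show "pattern_mat n (\<lambda>i j. i = j \<and> i < 2 \<or> i = 0 \<and> j = 1) \<in> carrier (sl TYPE('a) n)"
        by (rule pattern_mat_in_sl[OF assms(1), of _ _ "{0, 1}"]) (use 2 in auto)
      show "pattern_mat n (\<lambda>i j. i = 1 \<and> j = 0 \<or> i = 0 \<and> j = 2 \<or> i = 2 \<and> j = 0)
          \<in> carrier (sl TYPE('a) n)"
        by (rule pattern_mat_in_sl[OF assms(1), of _ _ "{}"]) auto
    qed (use 2 restricted_lie_mat.elementary_mem_of_dimension_3 in auto)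
  next
    case 3
    then obtain p where p: "n = Suc (Suc p)" "3 \<le> p"
      by (intro that[of "n - 2"]) simp_all
    show ?thesis
    proof (rule two_generated_sl_of_restricted[OF assms(1)])
      show "pattern_mat n (\<lambda>i j. i = j \<and> i < 2 \<or> i = p \<and> j = Suc p) \<in> carrier (sl TYPE('a) n)"
        by (rule pattern_mat_in_sl[OF assms(1), of _ _ "{0, 1}"]) (use p in auto)
      show "pattern_mat n (\<lambda>i j. j = Suc i \<or> i = Suc p \<and> j = 0) \<in> carrier (sl TYPE('a) n)"
        by (rule pattern_mat_in_sl[OF assms(1), of _ _ "{}"]) auto
    qed (use p restricted_lie_mat.elementary_mem_of_cycle[OF _ p(1) refl p(2)] in auto)
  qed
qed

end
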